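(* Suppose that $\sup_{q\in\mathbb{R}^n}\{\lambda_{\max}(M(q,\Theta))\}<\infty$ holds for all constant, physically consistent inertial parameters $\Theta=(\Phi_1^\top,\ldots,\Phi_N^\top)^\top\in\mathbb{R}^{10N}$ (i.e. whenever $f(\Phi_l)\succ0$ for all $l\in\{1,\ldots,N\}$). If the (time-dependent) inertial parameters $\Phi_1,\ldots,\Phi_N:[0,\infty)\to\mathbb{R}^{10}$ are physically consistent at all times and upper bounded, then the mass matrix is uniformly bounded through a finite upper bound; specifically, then there exists a constant $0\le\alpha_2<\infty$ with $0\preceq M(q,\Theta(t))\preceq\alpha_2\mathrm{I}_n$ for all $q\in\mathbb{R}^n$, $t\ge0$, that satisfies $$\alpha_2\le2\max_{l\in\{1,\ldots,N\}}\Big\{\sup_{t\ge0}\big\{\lambda_{\max}(f(\Phi_l(t)))\big\}\Big\}\;\sup_{q\in\mathbb{R}^n}\big\{\sigma_{\max}(\mathcal{Q}(q)J(q))^2\big\},$$ where the first factor (the maximum) is finite due to upper boundedness and the last factor is finite due to the supposition.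
   Context: Notation: $\mathrm{I}_p$ is the $p\times p$ identity, $\mathrm{sym}(p)$ the real symmetric $p\times p$ matrices, $\lambda_{\min},\lambda_{\max}$ the extremal eigenvalues of a symmetric matrix, $\sigma_{\max}(B)=\sqrt{\lambda_{\max}(B^\top B)}$. For $x\in\mathbb{R}^3$, $\mathcal{S}(x)$ is the skew-symmetric $3\times3$ matrix with $\mathcal{S}(x)y=x\times y$ for all $y\in\mathbb{R}^3$. Kinematics: an open kinematic chain of $N$ bodies with generalized coordinates $q\in\mathbb{R}^n$. Kinematic parameters are constant (standing assumption), so the forward kinematic map $F:\mathbb{R}^n\to\mathbb{R}^{6N}$ depends only on $q$; write $F(q)=(F_{z_1}(q)^\top,F_{\phi_1}(q)^\top,\ldots,F_{z_N}(q)^\top,F_{\phi_N}(q)^\top)^\top$ with $F_{z_l},F_{\phi_l}\in\mathbb{R}^3$ (position of the origin and rotation angles of the $l$th body-fixed frame), and $J(q)=\partial F(q)/\partial q\in\mathbb{R}^{6N\times n}$. Rotation angles $\phi\in\mathbb{R}^3$ parameterize rotation matrices $\mathcal{R}(\phi)\in\mathrm{SO}(3)$, and $E(\phi)\in\mathbb{R}^{3\times3}$ is the matrix such that along any differentiable curve $\phi(t)$ one has $\mathcal{R}(\phi)^\top\dot{\mathcal{R}}(\phi)=\mathcal{S}(E(\phi)\dot\phi)$. Set $Q(\phi)=\mathrm{diag}(\mathcal{R}(\phi)^\top,E(\phi))\in\mathbb{R}^{6\times6}$ and $\mathcal{Q}(q)=\mathrm{diag}(Q(F_{\phi_1}(q)),\ldots,Q(F_{\phi_N}(q)))\in\mathbb{R}^{6N\times6N}$.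 Inertial parameters: $\Phi_l\in\mathbb{R}^{10}$ has entries, in order, $m_l,h_{1,l},h_{2,l},h_{3,l},I_{11,l},I_{22,l},I_{33,l},I_{12,l},I_{23,l},I_{13,l}$; $h_l=(h_{1,l},h_{2,l},h_{3,l})^\top$, and $I_l\in\mathrm{sym}(3)$ is the symmetric matrix with entries $I_{ij,l}$. $\Theta=(\Phi_1^\top,\ldots,\Phi_N^\top)^\top\in\mathbb{R}^{10N}$. Define $$f(\Phi_l)=\begin{pmatrix}\frac12\mathrm{tr}(I_l)\mathrm{I}_3-I_l&h_l\\ h_l^\top&m_l\end{pmatrix}\in\mathrm{sym}(4),\qquad Z(\Phi_l)=\begin{pmatrix}m_l\mathrm{I}_3&-\mathcal{S}(h_l)\\ -\mathcal{S}(h_l)^\top&I_l\end{pmatrix}\in\mathrm{sym}(6),$$ $\mathcal{Z}(\Theta)=\mathrm{diag}(Z(\Phi_1),\ldots,Z(\Phi_N))$, and the mass matrix $$M(q,\Theta)=J(q)^\top\mathcal{Q}(q)^\top\mathcal{Z}(\Theta)\mathcal{Q}(q)J(q)\in\mathrm{sym}(n).$$ Inertial parameters may depend on time $t\ge0$. Definitions: physically consistent (at all times) means $f(\Phi_l)\succ0$ (resp. $f(\Phi_l(t))\succ0$ for all $t\ge0$) for all $l\in\{1,\ldots,N\}$. The inertial parameters are upper bounded if $\sup_{t\ge0}\{\lambda_{\max}(f(\Phi_l(t)))\}<\infty$ for all $l\in\{1,\ldots,N\}$. *)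

theory Defs
  imports "HOL-Analysis.Analysis"
begin

section \<open>Symmetric matrices\<close>

text \<open>For symmetric \<open>A\<close> the set of real eigenvalues is finite and nonempty, so \<open>lambda_max\<close>
  is a genuine maximum. It is unspecified in general for other matrices.\<close>

definition eigenvalues :: "real^'n^'n \<Rightarrow> real set" where
  "eigenvalues A = {c. \<exists>v. v \<noteq> 0 \<and> A *v v = c *\<^sub>R v}"

definition lambda_max :: "real^'n^'n \<Rightarrow> real" where
  "lambda_max A = Max (eigenvalues A)"

definition sigma_max :: "real^'n^'m \<Rightarrow> real" where
  "sigma_max B = sqrt (lambda_max (transpose B ** B))"

definition pos_def :: "real^'n^'n \<Rightarrow> bool" where
  "pos_def A \<longleftrightarrow> transpose A = A \<and> (\<forall>x. x \<noteq> 0 \<longrightarrow> 0 < x \<bullet> (A *v x))"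

definition pos_semidef :: "real^'n^'n \<Rightarrow> bool" where
  "pos_semidef A \<longleftrightarrow> transpose A = A \<and> (\<forall>x. 0 \<le> x \<bullet> (A *v x))"

definition loewner_le :: "real^'n^'n \<Rightarrow> real^'n^'n \<Rightarrow> bool"  (infix \<open>\<preceq>\<^sub>L\<close> 50) where
  "A \<preceq>\<^sub>L B \<longleftrightarrow> pos_semidef (B - A)"


section \<open>Block matrices\<close>

text \<open>A stacked index range is a sum type (\<open>Inl\<close> first); \<open>N\<close> equally sized blocks are indexed by
  pairs (block, position in block). In particular \<open>6 = 3 + 3\<close>, \<open>4 = 3 + 1\<close> and \<open>6N\<close> is
  \<open>'N \<times> (3 + 3)\<close>.\<close>

definition block_matrix ::
    "real^'c^'a \<Rightarrow> real^'d^'a \<Rightarrow> real^'c^'b \<Rightarrow> real^'d^'b \<Rightarrow> real^('c::finite + 'd::finite)^('a::finite + 'b::finite)" where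
  "block_matrix A B C D = (\<chi> i j.
     case i of
       Inl i' \<Rightarrow> (case j of Inl j' \<Rightarrow> A $ i' $ j' | Inr j' \<Rightarrow> B $ i' $ j')
     | Inr i' \<Rightarrow> (case j of Inl j' \<Rightarrow> C $ i' $ j' | Inr j' \<Rightarrow> D $ i' $ j'))"

definition block_diag :: "('N::finite \<Rightarrow> real^'b^'a) \<Rightarrow> real^('N \<times> 'b)^('N \<times> 'a)" where
  "block_diag A = (\<chi> i j. if fst i = fst j then A (fst i) $ snd i $ snd j else 0)"


section \<open>Inertial parameters\<close>

definition skew :: "real^3 \<Rightarrow> real^3^3" where
  "skew x = matrix (cross3 x)"

lemma skew_mult: "skew x *v y = cross3 x y"
  by (simp add: skew_def matrix_def matrix_vector_mult_def vec_eq_iff forall_3 sum_3 cross3_def axis_def)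

lemma transpose_skew: "transpose (skew x) = - skew x"
  by (simp add: skew_def matrix_def transpose_def vec_eq_iff forall_3 cross3_def axis_def)

text \<open>The vector \<open>\<Phi>\<close> is \<open>(m, h1, h2, h3, I11, I22, I33, I12, I23, I13)\<close>.\<close>

definition mass :: "real^10 \<Rightarrow> real" where
  "mass \<Phi> = \<Phi> $ 1"

definition first_moment :: "real^10 \<Rightarrow> real^3" where
  "first_moment \<Phi> = vector [\<Phi> $ 2, \<Phi> $ 3, \<Phi> $ 4]"

definition inertia :: "real^10 \<Rightarrow> real^3^3" where
  "inertia \<Phi> = vector
     [vector [\<Phi> $ 5, \<Phi> $ 8, \<Phi> $ 10],
      vector [\<Phi> $ 8, \<Phi> $ 6, \<Phi> $ 9],
      vector [\<Phi> $ 10, \<Phi> $ 9, \<Phi> $ 7]]"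

definition pseudo_inertia :: "real^10 \<Rightarrow> real^(3 + 1)^(3 + 1)" where
  "pseudo_inertia \<Phi> = block_matrix
     (mat (trace (inertia \<Phi>) / 2) - inertia \<Phi>)  (columnvector (first_moment \<Phi>))
     (rowvector (first_moment \<Phi>))               (mat (mass \<Phi>))"

definition spatial_inertia :: "real^10 \<Rightarrow> real^(3 + 3)^(3 + 3)" where
  "spatial_inertia \<Phi> = block_matrix
     (mat (mass \<Phi>))                          (- skew (first_moment \<Phi>))
     (- transpose (skew (first_moment \<Phi>)))   (inertia \<Phi>)"

definition physically_consistent :: "real^10^'N \<Rightarrow> bool" where
  "physically_consistent \<Theta> \<longleftrightarrow> (\<forall>l. pos_def (pseudo_inertia (\<Theta> $ l)))"

definition physically_consistent_at_all_times :: "(real \<Rightarrow> real^10^'N) \<Rightarrow> bool" where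
  "physically_consistent_at_all_times \<Theta> \<longleftrightarrow> (\<forall>t\<ge>0. physically_consistent (\<Theta> t))"

definition upper_bounded :: "(real \<Rightarrow> real^10^'N) \<Rightarrow> bool" where
  "upper_bounded \<Theta> \<longleftrightarrow>
     (\<forall>l. (SUP t\<in>{0..}. ereal (lambda_max (pseudo_inertia (\<Theta> t $ l)))) < \<infinity>)"


section \<open>Kinematics and mass matrix\<close>

text \<open>\<open>E\<close> maps the rates of the rotation angles to the body-fixed angular velocity.\<close>

definition rotation_parametrization :: "(real^3 \<Rightarrow> real^3^3) \<Rightarrow> (real^3 \<Rightarrow> real^3^3) \<Rightarrow> bool" where
  "rotation_parametrization R E \<longleftrightarrow>
     (\<forall>\<phi>. rotation_matrix (R \<phi>)) \<and>
     (\<forall>\<phi> \<phi>'. (\<forall>t. (\<phi> has_vector_derivative \<phi>' t) (at t)) \<longrightarrow>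
        (\<exists>R'. \<forall>t. ((\<lambda>s. R (\<phi> s)) has_vector_derivative R' t) (at t) \<and>
                  transpose (R (\<phi> t)) ** R' t = skew (E (\<phi> t) *v \<phi>' t)))"

text \<open>Body \<open>l\<close> occupies the components \<open>(l, Inl i)\<close> (position) and \<open>(l, Inr i)\<close>
  (rotation angles) of the forward kinematic map.\<close>

definition angles :: "(real^'n \<Rightarrow> real^('N::finite \<times> (3 + 3))) \<Rightarrow> 'N \<Rightarrow> real^'n \<Rightarrow> real^3" where
  "angles F l q = (\<chi> i. F q $ (l, Inr i))"

definition body_transform ::
    "(real^3 \<Rightarrow> real^3^3) \<Rightarrow> (real^3 \<Rightarrow> real^3^3) \<Rightarrow> real^3 \<Rightarrow> real^(3 + 3)^(3 + 3)" where
  "body_transform R E \<phi> = block_matrix (transpose (R \<phi>)) 0 0 (E \<phi>)"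

definition chain_transform ::
    "(real^3 \<Rightarrow> real^3^3) \<Rightarrow> (real^3 \<Rightarrow> real^3^3) \<Rightarrow> (real^'n \<Rightarrow> real^('N::finite \<times> (3 + 3))) \<Rightarrow>
     real^'n \<Rightarrow> real^('N \<times> (3 + 3))^('N \<times> (3 + 3))" where
  "chain_transform R E F q = block_diag (\<lambda>l. body_transform R E (angles F l q))"

definition chain_inertia :: "real^10^'N \<Rightarrow> real^('N \<times> (3 + 3))^('N \<times> (3 + 3))" where
  "chain_inertia \<Theta> = block_diag (\<lambda>l. spatial_inertia (\<Theta> $ l))"

definition mass_matrix ::
    "(real^3 \<Rightarrow> real^3^3) \<Rightarrow> (real^3 \<Rightarrow> real^3^3) \<Rightarrow> (real^'n \<Rightarrow> real^('N::finite \<times> (3 + 3))) \<Rightarrow>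
     real^'n \<Rightarrow> real^10^'N \<Rightarrow> real^'n^'n" where
  "mass_matrix R E F q \<Theta> =
     transpose (jacobian F (at q)) ** transpose (chain_transform R E F q) ** chain_inertia \<Theta>
       ** chain_transform R E F q ** jacobian F (at q)"

end

theory Submission
  imports Defs
begin

text \<open>
  Writing a body as a mass distribution, \<open>w \<bullet> Z w\<close> is (twice) the kinetic energy of the body moving
  with the twist \<open>w = (u, v)\<close>, and \<open>f\<close> is the matrix of second moments of the distribution. Hence
  \<open>w \<bullet> Z w = tr (A f A\<^sup>T)\<close> for the \<open>3 \<times> 4\<close> matrix \<open>A = (S(v), u)\<close>, whose squared Frobenius norm is
  \<open>2 |v|\<^sup>2 + |u|\<^sup>2\<close>. If \<open>f\<close> is positive definite, this gives \<open>0 \<le> w \<bullet> Z w \<le> 2 \<lambda>\<^sub>m\<^sub>a\<^sub>x(f) |w|\<^sup>2\<close>, and the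
  bound on the mass matrix follows by summing over the bodies. Finiteness of the supremum of
  \<open>\<sigma>\<^sub>m\<^sub>a\<^sub>x(Q J)\<^sup>2\<close> is the supposition for bodies with \<open>Z = I\<close>, that is \<open>m = 1\<close>, \<open>h = 0\<close>, \<open>I = I\<^sub>3\<close>.
\<close>

section \<open>The largest eigenvalue of a symmetric matrix\<close>

lemma symmetric_form_commute:
  fixes A :: "real^'n^'n"
  assumes "transpose A = A"
  shows "x \<bullet> (A *v y) = y \<bullet> (A *v x)"
  by (metis assms dot_lmul_matrix inner_commute transpose_matrix_vector)

text \<open>By symmetry, eigenvectors for distinct eigenvalues are orthogonal, and a pairwise
  orthogonal set in finite dimension is finite. This gives the \<open>Max\<close> in
  \<open>lambda_max\<close> its meaning.\<close>

lemma finite_eigenvalues: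
  fixes A :: "real^'n^'n"
  assumes sym: "transpose A = A"
  shows "finite (eigenvalues A)"
proof -
  define v where "v c = (SOME v. v \<noteq> 0 \<and> A *v v = c *\<^sub>R v)" for c
  have v: "v c \<noteq> 0 \<and> A *v v c = c *\<^sub>R v c" if "c \<in> eigenvalues A" for c
    using that unfolding eigenvalues_def v_def mem_Collect_eq by (rule someI_ex)
  have ortho: "v c \<bullet> v d = 0" if "c \<in> eigenvalues A" "d \<in> eigenvalues A" "c \<noteq> d" for c d
  proof -
    have "c * (v c \<bullet> v d) = d * (v c \<bullet> v d)"
      using symmetric_form_commute[OF sym, of "v c" "v d"] v[OF that(1)] v[OF that(2)]
      by (auto simp: inner_commute)
    then show ?thesis
      using \<open>c \<noteq> d\<close> by (metis mult_right_cancel)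
  qed
  \<comment> \<open>An eigenvector shared by two eigenvalues would be orthogonal to itself, hence
    zero.\<close>
  have "inj_on v (eigenvalues A)"
  proof (rule inj_onI, rule ccontr)
    fix c d assume "c \<in> eigenvalues A" "d \<in> eigenvalues A" "v c = v d" "c \<noteq> d"
    then show False
      using ortho[of c d] v[of d] by simp
  qed
  moreover have "finite (v ` eigenvalues A)"
    by (rule pairwise_orthogonal_imp_finite)
       (use ortho in \<open>auto simp: pairwise_def orthogonal_def\<close>)
  ultimately show ?thesis
    using finite_imageD by blast
qed

text \<open>A zero of a nonnegative form is a minimum. If \<open>B *v v\<close> were nonzero, a
  small step from \<open>v\<close> against this direction would make the form negative.\<close>

lemma pos_semidef_form_zero_imp_kernel:
  fixes B :: "real^'n^'n"
  assumes "pos_semidef B" and v: "v \<bullet> (B *v v) = 0"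
  shows "B *v v = 0"
proof (rule ccontr)
  define w where "w = B *v v"
  define s where "s = w \<bullet> w"
  define c where "c = w \<bullet> (B *v w)"
  \<comment> \<open>The form at \<open>v - t *\<^sub>R w\<close> equals
    \<open>t * (t * c - 2 * s)\<close>, so any \<open>t > 0\<close> with
    \<open>t * c < 2 * s\<close> will do. The \<open>+ 1\<close> covers
    \<open>c = 0\<close>.\<close>
  define t where "t = s / (c + 1)"
  have sym: "transpose B = B" and psd: "\<And>x. 0 \<le> x \<bullet> (B *v x)"
    using assms by (auto simp: pos_semidef_def)
  assume "B *v v \<noteq> 0"
  then have s: "s > 0"
    by (simp add: s_def w_def)
  have c: "c \<ge> 0"
    by (simp add: c_def psd)
  have "v \<bullet> (B *v w) = s"
    using symmetric_form_commute[OF sym, of v w] by (simp add: s_def w_def)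
  moreover have "w \<bullet> (B *v v) = s"
    by (simp add: s_def w_def)
  ultimately have "(v - t *\<^sub>R w) \<bullet> (B *v (v - t *\<^sub>R w)) = t * (t * c - 2 * s)"
    using v by (simp add: c_def matrix_vector_mult_diff_distrib matrix_vector_mult_scaleR
        inner_diff_left inner_diff_right algebra_simps)
  also have "\<dots> < 0"
  proof (rule mult_pos_neg)
    show "t > 0"
      using s c by (simp add: t_def)
    have "t * c < 2 * s"
      using s c by (simp add: t_def field_simps add_nonneg_pos)
    then show "t * c - 2 * s < 0"
      by simp
  qed
  finally show False
    using psd[of "v - t *\<^sub>R w"] by simp
qed

lemma transpose_mat_diff:
  fixes A :: "real^'n^'n"
  shows "transpose (mat c - A) = mat c - transpose A"
  by (auto simp: transpose_def mat_def vec_eq_iff)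

lemma mat_mult_vector: "mat c *v x = c *\<^sub>R (x :: real^'n)"
  by (simp add: matrix_vector_mult_def mat_def vec_eq_iff if_distrib[where f = "\<lambda>a. a * _"] cong: if_cong)

text \<open>The maximum \<open>\<mu>\<close> of the form on the unit sphere is an eigenvalue:
  \<open>mat \<mu> - A\<close> is positive semidefinite and its form vanishes at the maximizer,
  which therefore lies in its kernel.\<close>

lemma rayleigh_le_lambda_max:
  fixes A :: "real^'n^'n"
  assumes sym: "transpose A = A"
  shows "x \<bullet> (A *v x) \<le> lambda_max A * (x \<bullet> x)"
proof -
  have "continuous_on (sphere 0 1) (\<lambda>x. x \<bullet> (A *v x))"
    by (intro continuous_intros matrix_vector_mult_linear_continuous_on)
  then obtain v where v: "v \<in> sphere 0 1"
    and max: "\<And>x. x \<in> sphere 0 1 \<Longrightarrow> x \<bullet> (A *v x) \<le> v \<bullet> (A *v v)"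
    using continuous_attains_sup[of "sphere (0 :: real^'n) 1" "\<lambda>x. x \<bullet> (A *v x)"]
    by (auto simp: compact_sphere)
  define \<mu> where "\<mu> = v \<bullet> (A *v v)"
  \<comment> \<open>Both sides are homogeneous of degree two, so normalizing \<open>x\<close>
    reduces the claim to the sphere.\<close>
  have bound: "x \<bullet> (A *v x) \<le> \<mu> * (x \<bullet> x)" for x
  proof (cases "x = 0")
    case False
    have "(x /\<^sub>R norm x) \<bullet> (A *v (x /\<^sub>R norm x)) \<le> \<mu>"
      unfolding \<mu>_def by (rule max) (use False in simp)
    then have "(x \<bullet> (A *v x)) / (norm x * norm x) \<le> \<mu>"
      by (simp add: matrix_vector_mult_scaleR field_simps)
    then show ?thesis
      using False by (simp add: field_simps dot_square_norm power2_eq_square)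
  qed simp
  have "(mat \<mu> - A) *v v = 0"
  proof (rule pos_semidef_form_zero_imp_kernel)
    show "pos_semidef (mat \<mu> - A)"
      using bound by (simp add: pos_semidef_def transpose_mat_diff sym mat_mult_vector
          matrix_vector_mult_diff_rdistrib inner_diff_right)
    show "v \<bullet> ((mat \<mu> - A) *v v) = 0"
      using v by (simp add: \<mu>_def mat_mult_vector matrix_vector_mult_diff_rdistrib inner_diff_right
          dot_square_norm)
  qed
  then have "\<mu> \<in> eigenvalues A"
    using v by (auto simp: eigenvalues_def mat_mult_vector matrix_vector_mult_diff_rdistrib
        intro!: exI[of _ v])
  then have "\<mu> \<le> lambda_max A"
    unfolding lambda_max_def by (intro Max_ge finite_eigenvalues sym)
  then have "\<mu> * (x \<bullet> x) \<le> lambda_max A * (x \<bullet> x)"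
    by (intro mult_right_mono) auto
  with bound[of x] show ?thesis
    by linarith
qed

lemma lambda_max_nonneg:
  fixes A :: "real^'n^'n"
  assumes "pos_semidef A"
  shows "0 \<le> lambda_max A"
proof -
  have "axis undefined 1 \<noteq> (0 :: real^'n)"
    by (simp add: axis_eq_0_iff)
  then obtain x :: "real^'n" where "x \<noteq> 0"
    by blast
  have "0 \<le> x \<bullet> (A *v x)"
    using assms by (simp add: pos_semidef_def)
  also have "\<dots> \<le> lambda_max A * (x \<bullet> x)"
    using assms by (intro rayleigh_le_lambda_max) (simp add: pos_semidef_def)
  finally show ?thesis
    using \<open>x \<noteq> 0\<close> by (metis inner_gt_zero_iff mult_neg_pos not_le)
qed

lemma pos_def_imp_pos_semidef: "pos_def A \<Longrightarrow> pos_semidef A"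
  unfolding pos_def_def pos_semidef_def by (metis inner_zero_left less_imp_le order_refl)

section \<open>Gram matrices and the largest singular value\<close>

lemma transpose_gram: "transpose (transpose B ** B) = transpose B ** (B :: real^'n^'m)"
  by (simp add: matrix_transpose_mul transpose_transpose)

lemma transpose_mult_form: "x \<bullet> ((transpose B ** C) *v x) = (B *v x) \<bullet> (C *v x)"
  for B C :: "real^'n^'m"
  by (simp add: dot_lmul_matrix inner_commute[of x] flip: matrix_vector_mul_assoc)
     (simp add: inner_commute)

lemma pos_semidef_gram: "pos_semidef (transpose B ** B)"
  for B :: "real^'n^'m"
  by (simp add: pos_semidef_def transpose_gram transpose_mult_form)

lemma sigma_max_squared: "(sigma_max B)\<^sup>2 = lambda_max (transpose B ** B)"
  for B :: "real^'n^'m"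
  by (simp add: sigma_max_def lambda_max_nonneg pos_semidef_gram)

lemma norm_mult_le_sigma_max: "(B *v x) \<bullet> (B *v x) \<le> (sigma_max B)\<^sup>2 * (x \<bullet> x)"
  for B :: "real^'n^'m"
  using rayleigh_le_lambda_max[OF transpose_gram, of x B] by (simp add: sigma_max_squared transpose_mult_form)


section \<open>The spatial inertia matrix\<close>

lemma sum_UNIV_sum: "(\<Sum>i\<in>UNIV. g i) = (\<Sum>i\<in>UNIV. g (Inl i)) + (\<Sum>i\<in>UNIV. g (Inr i))"
  for g :: "'a::finite + 'b::finite \<Rightarrow> real"
  by (simp add: UNIV_Plus_UNIV[symmetric] sum.Plus comp_def del: UNIV_Plus_UNIV)

text \<open>The \<open>i\<close>-th row of the matrix \<open>A = (S(v), u)\<close> associated with the twist \<open>w = (u, v)\<close>.\<close>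

definition velocity_row :: "real^(3 + 3) \<Rightarrow> 3 \<Rightarrow> real^(3 + 1)" where
  "velocity_row w i = (\<chi> j. case j of
     Inl k \<Rightarrow> skew (\<chi> l. w $ Inr l) $ i $ k
   | Inr _ \<Rightarrow> w $ Inl i)"

text \<open>The matrix \<open>A\<close> sends (r, 1) to u + v x r, the velocity of the body point r;
  integrating its squared norm over the mass gives the trace of \<open>A f A^T\<close>, here written
  as a sum over rows. The proof compares both sides as polynomials in the entries.\<close>

lemma spatial_inertia_form:
  "w \<bullet> (spatial_inertia \<Phi> *v w) =
     (\<Sum>i\<in>UNIV. velocity_row w i \<bullet> (pseudo_inertia \<Phi> *v velocity_row w i))"
  by (simp add: inner_vec_def matrix_vector_mult_def sum_UNIV_sum sum_3 spatial_inertia_def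
      pseudo_inertia_def velocity_row_def block_matrix_def skew_def matrix_def cross3_def axis_def
      transpose_def mat_def columnvector_def rowvector_def first_moment_def mass_def inertia_def
      trace_def)
     (simp add: algebra_simps add_divide_distrib diff_divide_distrib)

text \<open>The rows contribute |u|^2 from the last column and 2 |v|^2 from the skew part, since
  each component of v occurs twice there. This is the origin of the factor 2 in the final
  bound.\<close>

lemma velocity_row_norm_le: "(\<Sum>i\<in>UNIV. velocity_row w i \<bullet> velocity_row w i) \<le> 2 * (w \<bullet> w)"
  by (simp add: inner_vec_def sum_UNIV_sum sum_3 velocity_row_def skew_def matrix_def cross3_def
      axis_def)

lemma transpose_spatial_inertia: "transpose (spatial_inertia \<Phi>) = spatial_inertia \<Phi>"
  by (simp add: vec_eq_iff split_sum_all transpose_def spatial_inertia_def block_matrix_def mat_def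
      inertia_def forall_3)

lemma spatial_inertia_form_bounds:
  assumes "pos_def (pseudo_inertia \<Phi>)"
  shows "0 \<le> w \<bullet> (spatial_inertia \<Phi> *v w)"
    and "w \<bullet> (spatial_inertia \<Phi> *v w) \<le> 2 * lambda_max (pseudo_inertia \<Phi>) * (w \<bullet> w)"
proof -
  have psd: "pos_semidef (pseudo_inertia \<Phi>)"
    using assms by (rule pos_def_imp_pos_semidef)
  then show "0 \<le> w \<bullet> (spatial_inertia \<Phi> *v w)"
    by (auto simp: spatial_inertia_form pos_semidef_def intro: sum_nonneg)
  have "w \<bullet> (spatial_inertia \<Phi> *v w)
      \<le> (\<Sum>i\<in>UNIV. lambda_max (pseudo_inertia \<Phi>) * (velocity_row w i \<bullet> velocity_row w i))"
    unfolding spatial_inertia_form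
    using psd by (intro sum_mono rayleigh_le_lambda_max) (simp add: pos_semidef_def)
  also have "\<dots> \<le> lambda_max (pseudo_inertia \<Phi>) * (2 * (w \<bullet> w))"
    unfolding sum_distrib_left[symmetric]
    by (intro mult_left_mono velocity_row_norm_le lambda_max_nonneg psd)
  finally show "w \<bullet> (spatial_inertia \<Phi> *v w) \<le> 2 * lambda_max (pseudo_inertia \<Phi>) * (w \<bullet> w)"
    by (simp add: mult_ac)
qed


section \<open>The mass matrix\<close>

lemma transpose_block_diag: "transpose (block_diag A) = block_diag (\<lambda>l. transpose (A l))"
  by (auto simp: vec_eq_iff transpose_def block_diag_def)

text \<open>Decouples the bodies: bounds for single blocks add up to bounds for the chain.\<close>

lemma block_diag_form:
  fixes A :: "'N::finite \<Rightarrow> real^'a^'a"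
  shows "x \<bullet> (block_diag A *v x) = (\<Sum>l\<in>UNIV. (\<chi> i. x $ (l, i)) \<bullet> (A l *v (\<chi> i. x $ (l, i))))"
proof -
  have mult: "(block_diag A *v x) $ (l, i) = (A l *v (\<chi> i. x $ (l, i))) $ i" for l i
  proof -
    have "(block_diag A *v x) $ (l, i)
        = (\<Sum>k\<in>UNIV. \<Sum>j\<in>UNIV. if l = k then A l $ i $ j * x $ (k, j) else 0)"
      unfolding sum.cartesian_product UNIV_Times_UNIV
      by (auto simp: matrix_vector_mult_def block_diag_def intro!: sum.cong)
    also have "\<dots> = (\<Sum>k\<in>UNIV. if l = k then \<Sum>j\<in>UNIV. A l $ i $ j * x $ (k, j) else 0)"
      by (intro sum.cong) auto
    finally show ?thesis
      by (simp add: matrix_vector_mult_def)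
  qed
  have "x \<bullet> (block_diag A *v x)
      = (\<Sum>l\<in>UNIV. \<Sum>i\<in>UNIV. x $ (l, i) * (block_diag A *v x) $ (l, i))"
    unfolding sum.cartesian_product UNIV_Times_UNIV
    by (auto simp: inner_vec_def intro!: sum.cong)
  then show ?thesis
    by (simp add: mult) (simp add: inner_vec_def)
qed

lemma inner_blocks:
  fixes x :: "real^('N::finite \<times> 'a::finite)"
  shows "x \<bullet> x = (\<Sum>l\<in>UNIV. (\<chi> i. x $ (l, i)) \<bullet> (\<chi> i. x $ (l, i)))"
proof -
  have "x \<bullet> x = (\<Sum>l\<in>UNIV. \<Sum>i\<in>UNIV. x $ (l, i) * x $ (l, i))"
    unfolding sum.cartesian_product UNIV_Times_UNIV
    by (auto simp: inner_vec_def intro!: sum.cong)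
  then show ?thesis
    by (simp add: inner_vec_def)
qed

lemma transpose_chain_inertia: "transpose (chain_inertia \<Theta>) = chain_inertia \<Theta>"
  by (simp add: chain_inertia_def transpose_block_diag transpose_spatial_inertia)

lemma chain_inertia_form_bounds:
  assumes "physically_consistent \<Theta>"
    and "\<And>l. lambda_max (pseudo_inertia (\<Theta> $ l)) \<le> k"
  shows "0 \<le> y \<bullet> (chain_inertia \<Theta> *v y)" and "y \<bullet> (chain_inertia \<Theta> *v y) \<le> 2 * k * (y \<bullet> y)"
proof -
  have pd: "pos_def (pseudo_inertia (\<Theta> $ l))" for l
    using assms(1) by (simp add: physically_consistent_def)
  show "0 \<le> y \<bullet> (chain_inertia \<Theta> *v y)"
    unfolding chain_inertia_def block_diag_form
    by (intro sum_nonneg spatial_inertia_form_bounds(1) pd)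
  have "w \<bullet> (spatial_inertia (\<Theta> $ l) *v w) \<le> 2 * k * (w \<bullet> w)" for l w
  proof -
    have "2 * lambda_max (pseudo_inertia (\<Theta> $ l)) * (w \<bullet> w) \<le> 2 * k * (w \<bullet> w)"
      using assms(2)[of l] by (intro mult_right_mono) auto
    then show ?thesis
      using spatial_inertia_form_bounds(2)[OF pd, of w l] by linarith
  qed
  then show "y \<bullet> (chain_inertia \<Theta> *v y) \<le> 2 * k * (y \<bullet> y)"
    unfolding chain_inertia_def block_diag_form inner_blocks sum_distrib_left
    by (intro sum_mono)
qed

text \<open>Exhibits the mass matrix as a congruence of \<open>chain_inertia\<close> by
  \<open>B\<close>, so its symmetry and its form are inherited from the inertia.\<close>

lemma mass_matrix_eq:
  fixes R E F q
  defines "B \<equiv> chain_transform R E F q ** jacobian F (at q)"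
  shows "mass_matrix R E F q \<Theta> = transpose B ** (chain_inertia \<Theta> ** B)"
  by (simp add: mass_matrix_def B_def matrix_transpose_mul matrix_mul_assoc)

lemma transpose_mass_matrix: "transpose (mass_matrix R E F q \<Theta>) = mass_matrix R E F q \<Theta>"
  by (simp add: mass_matrix_eq matrix_transpose_mul transpose_chain_inertia matrix_mul_assoc)

lemma mass_matrix_form:
  fixes R E F q
  defines "B \<equiv> chain_transform R E F q ** jacobian F (at q)"
  shows "x \<bullet> (mass_matrix R E F q \<Theta> *v x) = (B *v x) \<bullet> (chain_inertia \<Theta> *v (B *v x))"
  unfolding mass_matrix_eq B_def[symmetric] transpose_mult_form by (simp add: matrix_vector_mul_assoc)

text \<open>Entries 1, 5, 6, 7 are the mass and the diagonal moments of inertia. With these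
  parameters for every body, the mass matrix is the Gram matrix of \<open>chain_transform\<close>
  times the Jacobian.\<close>

definition unit_inertia :: "real^10" where
  "unit_inertia = (\<chi> i. if i = 1 \<or> i = 5 \<or> i = 6 \<or> i = 7 then 1 else 0)"

lemma spatial_unit_inertia: "spatial_inertia unit_inertia = mat 1"
  by (simp add: vec_eq_iff split_sum_all spatial_inertia_def block_matrix_def mat_def inertia_def
      skew_def matrix_def cross3_def transpose_def mass_def first_moment_def unit_inertia_def forall_3)

text \<open>The pseudo-inertia is diag(1/2, 1/2, 1/2, 1), because half the trace of the identity
  minus one is 1/2.\<close>

lemma pos_def_pseudo_unit_inertia: "pos_def (pseudo_inertia unit_inertia)"
proof -
  have "transpose (pseudo_inertia unit_inertia) = pseudo_inertia unit_inertia"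
    by (simp add: vec_eq_iff split_sum_all pseudo_inertia_def block_matrix_def mat_def inertia_def
        transpose_def unit_inertia_def columnvector_def rowvector_def forall_3)
  moreover have "0 < x \<bullet> (pseudo_inertia unit_inertia *v x)" if "x \<noteq> 0" for x
  proof -
    have "x \<bullet> (pseudo_inertia unit_inertia *v x)
        = ((x $ Inl 1)\<^sup>2 + (x $ Inl 2)\<^sup>2 + (x $ Inl 3)\<^sup>2) / 2 + (x $ Inr 1)\<^sup>2"
      by (simp add: inner_vec_def matrix_vector_mult_def sum_UNIV_sum sum_3 pseudo_inertia_def
          block_matrix_def mat_def inertia_def mass_def first_moment_def unit_inertia_def
          columnvector_def rowvector_def trace_def power2_eq_square forall_3 field_simps)
    moreover have "0 < (x $ Inl 1)\<^sup>2 + (x $ Inl 2)\<^sup>2 + (x $ Inl 3)\<^sup>2 + (x $ Inr 1)\<^sup>2"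
    proof -
      have "x \<bullet> x = (x $ Inl 1)\<^sup>2 + (x $ Inl 2)\<^sup>2 + (x $ Inl 3)\<^sup>2 + (x $ Inr 1)\<^sup>2"
        by (simp add: inner_vec_def sum_UNIV_sum sum_3 power2_eq_square)
      then show ?thesis
        using that by (metis inner_gt_zero_iff)
    qed
    ultimately show ?thesis
      using zero_le_power2[of "x $ Inr 1"] by argo
  qed
  ultimately show ?thesis
    by (simp add: pos_def_def)
qed

lemma chain_unit_inertia: "chain_inertia (\<chi> l. unit_inertia) = mat 1"
  by (auto simp: chain_inertia_def spatial_unit_inertia block_diag_def mat_def vec_eq_iff prod_eq_iff)

theorem theorem3:
  fixes F :: "real^'n \<Rightarrow> real^('N::finite \<times> (3 + 3))"
    and R E :: "real^3 \<Rightarrow> real^3^3"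
    and \<Theta> :: "real \<Rightarrow> real^10^'N"
  assumes "\<forall>q. F differentiable (at q)"
    and "rotation_parametrization R E"
    and "\<forall>\<Theta>\<^sub>0 :: real^10^'N. physically_consistent \<Theta>\<^sub>0 \<longrightarrow>
           (SUP q. ereal (lambda_max (mass_matrix R E F q \<Theta>\<^sub>0))) < \<infinity>"
    and "physically_consistent_at_all_times \<Theta>"
    and "upper_bounded \<Theta>"
  shows "(MAX l. SUP t\<in>{0..}. ereal (lambda_max (pseudo_inertia (\<Theta> t $ l)))) < \<infinity> \<and>
    (SUP q. ereal ((sigma_max (chain_transform R E F q ** jacobian F (at q)))\<^sup>2)) < \<infinity> \<and>
    (\<exists>\<alpha>\<^sub>2 \<ge> 0.
       (\<forall>q. \<forall>t\<ge>0. 0 \<preceq>\<^sub>L mass_matrix R E F q (\<Theta> t) \<and>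
                   mass_matrix R E F q (\<Theta> t) \<preceq>\<^sub>L mat \<alpha>\<^sub>2) \<and>
       ereal \<alpha>\<^sub>2 \<le> 2 * (MAX l. SUP t\<in>{0..}. ereal (lambda_max (pseudo_inertia (\<Theta> t $ l))))
                    * (SUP q. ereal ((sigma_max (chain_transform R E F q ** jacobian F (at q)))\<^sup>2)))"
proof -
  define B where "B q = chain_transform R E F q ** jacobian F (at q)" for q
  define K where "K = (MAX l. SUP t\<in>{0..}. ereal (lambda_max (pseudo_inertia (\<Theta> t $ l))))"
  define S where "S = (SUP q. ereal ((sigma_max (B q))\<^sup>2))"
  have pc: "physically_consistent (\<Theta> t)" if "t \<ge> 0" for t
    using assms(4) that by (simp add: physically_consistent_at_all_times_def)

  have K_fin: "K < \<infinity>"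
    using assms(5) unfolding K_def upper_bounded_def by (subst Max_less_iff) auto
  have K_ge: "ereal (lambda_max (pseudo_inertia (\<Theta> t $ l))) \<le> K" if "t \<ge> 0" for t l
  proof -
    have "ereal (lambda_max (pseudo_inertia (\<Theta> t $ l)))
        \<le> (SUP t\<in>{0..}. ereal (lambda_max (pseudo_inertia (\<Theta> t $ l))))"
      using that by (intro SUP_upper) auto
    also have "\<dots> \<le> K"
      unfolding K_def by (intro Max_ge) auto
    finally show ?thesis .
  qed
  \<comment> \<open>An arbitrary body at time 0 bounds \<open>K\<close> below by a nonnegative
    number. This excludes minus infinity, so \<open>K\<close> is a real \<open>k\<close>.\<close>
  have "0 \<le> lambda_max (pseudo_inertia (\<Theta> 0 $ undefined))"
    using pc[of 0] by (intro lambda_max_nonneg pos_def_imp_pos_semidef)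
      (simp add: physically_consistent_def)
  then have K_nonneg: "0 \<le> K"
    using K_ge[of 0 undefined] by (meson ereal_less_eq(5) order_refl order_trans)
  obtain k where k: "K = ereal k" "k \<ge> 0"
    using K_fin K_nonneg by (cases K) auto

  \<comment> \<open>For unit inertia the largest eigenvalue of the mass matrix is the squared
    \<open>sigma_max\<close> of \<open>B q\<close>, so the supposition bounds exactly
    \<open>S\<close>.\<close>
  have "mass_matrix R E F q (\<chi> l. unit_inertia) = transpose (B q) ** B q" for q
    by (simp add: mass_matrix_eq chain_unit_inertia B_def)
  moreover have "physically_consistent (\<chi> l :: 'N. unit_inertia)"
    by (simp add: physically_consistent_def pos_def_pseudo_unit_inertia)
  ultimately have S_fin: "S < \<infinity>"
    using assms(3)[rule_format, of "\<chi> l. unit_inertia"] by (simp add: S_def sigma_max_squared)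
  have S_ge: "ereal ((sigma_max (B q))\<^sup>2) \<le> S" for q
    unfolding S_def by (intro SUP_upper) auto
  then have "0 \<le> S"
    by (meson ereal_less_eq(5) order_trans zero_le_power2)
  then obtain s where s: "S = ereal s" "s \<ge> 0"
    using S_fin by (cases S) auto

  \<comment> \<open>The witness is \<open>2 * k * s\<close>, the real value of
    \<open>2 * K * S\<close>, so the required estimate for it holds with equality.\<close>
  have "0 \<preceq>\<^sub>L mass_matrix R E F q (\<Theta> t) \<and> mass_matrix R E F q (\<Theta> t) \<preceq>\<^sub>L mat (2 * k * s)"
    if t: "t \<ge> 0" for q t
  proof -
    have "lambda_max (pseudo_inertia (\<Theta> t $ l)) \<le> k" for l
      using K_ge[OF t, of l] k by simp
    note bounds = chain_inertia_form_bounds[OF pc[OF t] this]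
    have "x \<bullet> (mass_matrix R E F q (\<Theta> t) *v x) \<le> 2 * k * s * (x \<bullet> x)" for x
    proof -
      have "x \<bullet> (mass_matrix R E F q (\<Theta> t) *v x) \<le> 2 * k * ((B q *v x) \<bullet> (B q *v x))"
        using bounds(2)[of "B q *v x"] by (simp add: mass_matrix_form B_def)
      also have "\<dots> \<le> 2 * k * (s * (x \<bullet> x))"
      proof (rule mult_left_mono)
        have "(sigma_max (B q))\<^sup>2 * (x \<bullet> x) \<le> s * (x \<bullet> x)"
          using S_ge[of q] s by (intro mult_right_mono) auto
        then show "(B q *v x) \<bullet> (B q *v x) \<le> s * (x \<bullet> x)"
          using norm_mult_le_sigma_max[of "B q" x] by linarith
      qed (use k in simp)
      finally show ?thesis
        by (simp add: mult_ac)
    qed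
    then show ?thesis
      using bounds(1) by (simp add: loewner_le_def pos_semidef_def transpose_mass_matrix
          transpose_mat_diff mass_matrix_form mat_mult_vector matrix_vector_mult_diff_rdistrib
          inner_diff_right)
  qed
  moreover have "ereal (2 * k * s) \<le> 2 * K * S"
    using k s by simp
  moreover have "0 \<le> 2 * k * s"
    using k s by simp
  ultimately show ?thesis
    using K_fin S_fin unfolding K_def S_def B_def by blast
qed

end
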